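(* Let $n\geq 2$, let $\sigma=\{v_0,\dots,v_n\}\subseteq\mathbb{R}^n$ be a non-degenerate $n$-dimensional simplex, let $0\leq k\leq n-1$, and let $\tau=\{v_0,\dots,v_k\}$ and $\tau^*=\sigma\setminus\tau=\{v_{k+1},\dots,v_n\}$. Let $$\hat{v}=(v_1-v_0)\times\dots\times(v_k-v_0)\times(v_{k+1}-v_n)\times\dots\times(v_{n-1}-v_n)$$ be the generalized cross product of these $n-1$ vectors. Then $$\mathrm{alt}(\tau,\tau^* )=\frac{\left|\langle v_0-v_n,\hat{v}\rangle\right|}{\mathrm{vol}_{n-1}P(v_1-v_0,\dots,v_k-v_0,v_{k+1}-v_n,\dots,v_{n-1}-v_n)}.$$
   Context: $\mathbb{R}^n$ carries the standard Euclidean inner product $\langle\cdot,\cdot\rangle$ and norm $\|\cdot\|$. A simplex is identified with its set of vertices; $\sigma=\{v_0,\dots,v_n\}\subseteq\mathbb{R}^n$ is non-degenerate if its vertices are affinely independent. Altitude: let $\mathcal{F}_\tau$ and $\mathcal{F}_{\tau^*}$ denote the affine hulls of $\tau$ and $\tau^*$. The (generalized) altitude of $\tau$ and $\tau^*$ is $$\mathrm{alt}(\tau,\tau^* )=\min_{u\in\mathcal{F}_\tau,\;u^*\in\mathcal{F}_{\tau^*}}\|u-u^*\|.$$ Generalized cross product: for linearly independent vectors $x_1,\dots,x_{n-1}\in\mathbb{R}^n$, $x_1\times\dots\times x_{n-1}$ is the unique vector in $\mathbb{R}^n$ such that $\langle b,x_1\times\dots\times x_{n-1}\rangle=\det(b,x_1,\dots,x_{n-1})$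 for every $b\in\mathbb{R}^n$. The list of vectors in the definition of $\hat v$ is $v_i-v_0$ for $1\le i\le k$ followed by $v_j-v_n$ for $k+1\le j\le n-1$ (the first part is empty if $k=0$, the second if $k=n-1$). Parallelepiped: $P(x_1,\dots,x_{n-1})=\left\{\sum_{i=1}^{n-1}t_ix_i : 0\leq t_i\leq 1\right\}$, and $\mathrm{vol}_{n-1}P(x_1,\dots,x_{n-1})$ is its $(n-1)$-dimensional volume, which equals $\sqrt{\det G(x_1,\dots,x_{n-1})}$ with Gram matrix $G(x_1,\dots,x_{n-1})=(\langle x_i,x_j\rangle)_{i,j=1,\dots,n-1}$. *)

theory Defs
  imports "HOL-Analysis.Analysis"
begin

definition alt :: "'a::euclidean_space set \<Rightarrow> 'a set \<Rightarrow> real" where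
  "alt S T = (LEAST d. \<exists>u \<in> affine hull S. \<exists>u' \<in> affine hull T. d = norm (u - u'))"

text \<open>The linear order on the index type plays the role of the order of the coordinates of
  \<open>real ^ 'n\<close>: the index \<open>j\<close> is the \<open>card {l. l < j}\<close>-th one, counting from \<open>0\<close>. Hence
  \<open>det_list [y\<^sub>0, \<dots>, y\<^sub>m]\<close>, with \<open>m + 1 = CARD('n)\<close>, is the determinant of the matrix with
  columns \<open>y\<^sub>0, \<dots>, y\<^sub>m\<close> in this order. It is only meaningful for lists of length \<open>CARD('n)\<close>.\<close>

definition det_list :: "(real ^ 'n::{finite,linorder}) list \<Rightarrow> real" where
  "det_list ys = det (\<chi> i j. (ys ! card {l. l < j}) $ i)"

definition cross_product :: "(real ^ 'n::{finite,linorder}) list \<Rightarrow> real ^ 'n::{finite,linorder}" where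
  "cross_product xs = (THE w. \<forall>b. b \<bullet> w = det_list (b # xs))"

definition parallelepiped :: "'a::real_vector list \<Rightarrow> 'a set" where
  "parallelepiped xs =
     {(\<Sum>i<length xs. t i *\<^sub>R xs ! i) | t. \<forall>i<length xs. 0 \<le> t i \<and> t i \<le> 1}"

definition orthonormal_family :: "nat \<Rightarrow> (nat \<Rightarrow> 'a::real_inner) \<Rightarrow> bool" where
  "orthonormal_family k e \<longleftrightarrow> (\<forall>i<k. \<forall>j<k. e i \<bullet> e j = (if i = j then 1 else 0))"

text \<open>The \<open>k\<close>-dimensional volume of a Borel set \<open>S\<close> contained in a \<open>k\<close>-dimensional linear
  subspace: the \<open>k\<close>-dimensional Lebesgue measure of the set of coordinate vectors of the points
  of \<open>S\<close> with respect to an orthonormal basis of such a subspace. By invariance of Lebesgue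
  measure under linear isometries the value does not depend on the basis (nor on the subspace, if
  there are several). It is meaningless if no such subspace exists.\<close>

definition subspace_volume :: "nat \<Rightarrow> 'a::euclidean_space set \<Rightarrow> real" where
  "subspace_volume k S =
     (let e = (SOME e. orthonormal_family k e \<and> S \<subseteq> span (e ` {..<k}))
      in measure (Pi\<^sub>M {..<k} (\<lambda>_. lborel))
           {c \<in> space (Pi\<^sub>M {..<k} (\<lambda>_. lborel)). (\<Sum>i<k. c i *\<^sub>R e i) \<in> S})"

end

(* The linear hull W of the n - 1 listed vectors is the sum of the direction spaces of the two affine
   hulls, so the differences u - u' form the translate of W by c = v 0 - v n, and the altitude is the
   length |<c, \<nu>>| of the component of c along a unit normal \<nu> of W. The cross product is orthogonal to W,
   hence <c, cross product> = <c, \<nu>> det(\<nu>, xs). Finally |det(\<nu>, xs)| is the n-dimensional volume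
   of the right prism of height 1 over the parallelepiped, that is, the (n - 1)-dimensional volume
   of its base, and it does not vanish as the simplex is non-degenerate. *)

theory Submission
  imports Defs
begin

subsection \<open>Determinants of lists of columns\<close>

definition col_index :: "'n::{finite,linorder} \<Rightarrow> nat" where
  "col_index j = card {l. l < j}"

definition column_matrix ::
  "(real ^ 'n::{finite,linorder}) list \<Rightarrow> real ^ 'n::{finite,linorder} ^ 'n::{finite,linorder}" where
  "column_matrix ys = (\<chi> i j. (ys ! col_index j) $ i)"

lemma det_list_eq: "det_list ys = det (column_matrix ys)"
  by (simp add: det_list_def column_matrix_def col_index_def)

text \<open>The rank is strictly increasing, hence injective, and it maps into a set with as many
  elements as the index type.\<close>

lemma bij_betw_col_index: "bij_betw (col_index :: 'n::{finite,linorder} \<Rightarrow> nat) UNIV {..<CARD('n)}"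
proof -
  have less: "col_index i < col_index j" if "i < j" for i j :: 'n
    unfolding col_index_def using that by (intro psubset_card_mono) auto
  have inj: "inj (col_index :: 'n \<Rightarrow> nat)"
    by (rule injI) (metis less less_irrefl linorder_neqE)
  have "col_index j < CARD('n)" for j :: 'n
    unfolding col_index_def by (intro psubset_card_mono) auto
  then have "range (col_index :: 'n \<Rightarrow> nat) \<subseteq> {..<CARD('n)}"
    by auto
  then have "range (col_index :: 'n \<Rightarrow> nat) = {..<CARD('n)}"
    by (intro card_subset_eq) (auto simp: card_image inj)
  with inj show ?thesis
    by (simp add: bij_betw_def)
qed

lemma col_index_less [simp]: "col_index (j :: 'n::{finite,linorder}) < CARD('n)"
  using bij_betw_col_index[where 'n = 'n] by (auto simp: bij_betw_def)

lemma inj_col_index: "inj (col_index :: 'n::{finite,linorder} \<Rightarrow> nat)"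
  using bij_betw_col_index by (rule bij_betw_imp_inj_on)

lemma col_index_eq_iff [simp]: "col_index i = col_index j \<longleftrightarrow> i = j"
  using inj_col_index by (rule inj_eq)

lemma obtain_col_index:
  assumes "i < CARD('n)"
  obtains j :: "'n::{finite,linorder}" where "col_index j = i"
proof -
  have "i \<in> range (col_index :: 'n \<Rightarrow> nat)"
    using bij_betw_col_index[where 'n = 'n] assms by (simp add: bij_betw_def)
  then show ?thesis
    using that by auto
qed

lemma column_column_matrix [simp]: "column j (column_matrix ys) = ys ! col_index j"
  by (simp add: column_def column_matrix_def)

lemma column_matrix_mult:
  "column_matrix ys *v x = (\<Sum>j\<in>UNIV. x $ j *\<^sub>R ys ! col_index j)"
  by (simp add: matrix_mult_sum scalar_mult_eq_scaleR)

lemma column_matrix_mult_col_index: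
  "column_matrix ys *v (\<chi> j. t (col_index j)) =
    (\<Sum>i<CARD('n). t i *\<^sub>R (ys ! i :: real ^ 'n::{finite,linorder}))"
  by (simp add: column_matrix_mult sum.reindex_bij_betw[OF bij_betw_col_index, symmetric])

lemma columns_column_matrix:
  fixes ys :: "(real ^ 'n::{finite,linorder}) list"
  assumes "length ys = CARD('n)"
  shows "columns (column_matrix ys) = set ys"
proof -
  have "columns (column_matrix ys) = (\<lambda>i. ys ! i) ` range (col_index :: 'n \<Rightarrow> nat)"
    by (auto simp: columns_def)
  then show ?thesis
    using bij_betw_col_index[where 'n = 'n] assms
    by (auto simp: bij_betw_def set_conv_nth)
qed

text \<open>Spanning columns give a right inverse, and a square matrix with a right inverse is
  invertible.\<close>

lemma det_list_nonzero:
  fixes ys :: "(real ^ 'n::{finite,linorder}) list"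
  assumes "length ys = CARD('n)" and "span (set ys) = UNIV"
  shows "det_list ys \<noteq> 0"
proof -
  have "\<exists>B. column_matrix ys ** B = mat 1"
    using matrix_right_invertible_span_columns[of "column_matrix ys"] assms
    by (simp add: columns_column_matrix span_vec_eq)
  then show ?thesis
    by (metis det_list_eq invertible_det_nz invertible_right_inverse)
qed

section \<open>The first column of the determinant and the cross product\<close>

lemma linear_det_list_Cons:
  "linear (\<lambda>b :: real ^ 'n::{finite,linorder}. det_list (b # xs))"
proof -
  obtain j\<^sub>0 :: 'n where j0: "col_index j\<^sub>0 = 0"
    using obtain_col_index[of 0] zero_less_card_finite by metis
  \<comment> \<open>Transposition moves \<open>b\<close> from the first column to row
    \<open>j\<^sub>0\<close>, where multilinearity in a row applies. The truncated
    \<open>col_index j - 1\<close> at rank 0 is masked by the \<open>if\<close>.\<close>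
  have eq: "det_list (b # xs) = det (\<chi> j. if j = j\<^sub>0 then b else xs ! (col_index j - 1))"
    for b :: "(real, 'n) vec"
  proof -
    have "col_index j = 0 \<longleftrightarrow> j = j\<^sub>0" for j
      using j0 by (metis col_index_eq_iff)
    then have "transpose (column_matrix (b # xs)) = (\<chi> j. if j = j\<^sub>0 then b else xs ! (col_index j - 1))"
      by (auto simp: vec_eq_iff transpose_def column_matrix_def nth_Cons')
    then show ?thesis
      by (metis det_list_eq det_transpose)
  qed
  show ?thesis
  proof (rule linearI)
    show "det_list ((b + c) # xs) = det_list (b # xs) + det_list (c # xs)" for b c :: "(real, 'n) vec"
      unfolding eq using det_row_add[of j\<^sub>0 "\<lambda>_. b" "\<lambda>_. c"] by simp
    show "det_list ((r *\<^sub>R b) # xs) = r *\<^sub>R det_list (b # xs)" for r and b :: "(real, 'n) vec"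
      unfolding eq using det_row_mul[of j\<^sub>0 r "\<lambda>_. b" "\<lambda>j. xs ! (col_index j - 1)"]
      by (simp add: scalar_mult_eq_scaleR cong: if_cong)
  qed
qed

text \<open>The matrix has two equal columns: \<open>x\<close> at rank 0 and its occurrence in
  \<open>xs\<close>, shifted by one. The length bound makes the shifted position the rank of some
  index.\<close>

lemma det_list_Cons_member:
  fixes xs :: "(real ^ 'n::{finite,linorder}) list"
  assumes "x \<in> set xs" and "length xs < CARD('n)"
  shows "det_list (x # xs) = 0"
proof -
  obtain i where i: "i < length xs" "xs ! i = x"
    using assms by (auto simp: in_set_conv_nth)
  obtain j j' :: 'n where "col_index j = 0" "col_index j' = Suc i"
    using obtain_col_index[of 0] obtain_col_index[of "Suc i"] i assms(2) zero_less_card_finite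
    by (metis Suc_leI le_less_trans)
  then show ?thesis
    unfolding det_list_eq using i
    by (intro det_identical_columns[of j j']) auto
qed

text \<open>Justifies the definite description: the determinant is a linear functional of its first
  column, so it has a unique Riesz representative.\<close>

lemma inner_cross_product:
  fixes b :: "real ^ 'n::{finite,linorder}"
  shows "b \<bullet> cross_product xs = det_list (b # xs)"
proof -
  interpret linear "\<lambda>b :: (real, 'n) vec. det_list (b # xs)"
    by (rule linear_det_list_Cons)
  \<comment> \<open>The Riesz vector: its coordinates are the values of the functional on the
    standard basis.\<close>
  define w where "w = (\<Sum>a\<in>Basis. det_list (a # xs) *\<^sub>R (a :: (real, 'n) vec))"
  have w: "b \<bullet> w = det_list (b # xs)" for b
  proof -
    have "det_list (b # xs) = det_list ((\<Sum>a\<in>Basis. (b \<bullet> a) *\<^sub>R a) # xs)"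
      by (simp add: euclidean_representation)
    also have "\<dots> = b \<bullet> w"
      by (simp add: sum scale w_def inner_sum_right mult.commute)
    finally show ?thesis ..
  qed
  have "\<forall>b. b \<bullet> cross_product xs = det_list (b # xs)"
    unfolding cross_product_def
  proof (rule theI)
    show "\<forall>b. b \<bullet> w = det_list (b # xs)"
      by (simp add: w)
    show "z = w" if "\<forall>b. b \<bullet> z = det_list (b # xs)" for z
      using that w by (metis vector_eq_ldot)
  qed
  then show ?thesis
    by blast
qed

subsection \<open>The volume of a parallelepiped\<close>

lemma parallelepiped_Nil: "parallelepiped [] = {0}"
  by (auto simp: parallelepiped_def)

lemma parallelepiped_Cons:
  "parallelepiped (x # xs) = {s *\<^sub>R x + y | s y. s \<in> {0..1} \<and> y \<in> parallelepiped xs}"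
proof (intro set_eqI iffI)
  fix z
  assume "z \<in> parallelepiped (x # xs)"
  then obtain t where t: "z = (\<Sum>i<Suc (length xs). t i *\<^sub>R (x # xs) ! i)"
      "\<forall>i<Suc (length xs). 0 \<le> t i \<and> t i \<le> 1"
    by (auto simp: parallelepiped_def)
  then have "z = t 0 *\<^sub>R x + (\<Sum>i<length xs. t (Suc i) *\<^sub>R xs ! i)"
    by (simp add: sum.lessThan_Suc_shift del: sum.lessThan_Suc)
  with t(2) show "z \<in> {s *\<^sub>R x + y | s y. s \<in> {0..1} \<and> y \<in> parallelepiped xs}"
    unfolding parallelepiped_def by fastforce
next
  fix z
  assume "z \<in> {s *\<^sub>R x + y | s y. s \<in> {0..1} \<and> y \<in> parallelepiped xs}"
  then obtain s t where st: "z = s *\<^sub>R x + (\<Sum>i<length xs. t i *\<^sub>R xs ! i)"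
      "0 \<le> s" "s \<le> 1" "\<forall>i<length xs. 0 \<le> t i \<and> t i \<le> 1"
    by (auto simp: parallelepiped_def)
  let ?t = "\<lambda>i. case i of 0 \<Rightarrow> s | Suc j \<Rightarrow> t j"
  have "z = (\<Sum>i<Suc (length xs). ?t i *\<^sub>R (x # xs) ! i)"
    by (simp add: st(1) sum.lessThan_Suc_shift del: sum.lessThan_Suc)
  moreover have "\<forall>i<Suc (length xs). 0 \<le> ?t i \<and> ?t i \<le> 1"
    using st by (auto split: nat.split)
  ultimately show "z \<in> parallelepiped (x # xs)"
    unfolding parallelepiped_def by (auto simp del: sum.lessThan_Suc)
qed

text \<open>A Minkowski sum of segments. Compactness later supplies Borel measurability.\<close>

lemma compact_parallelepiped: "compact (parallelepiped xs :: 'a::euclidean_space set)"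
proof (induction xs)
  case (Cons x xs)
  have "compact ((\<lambda>s. s *\<^sub>R x) ` {0..1})"
    by (intro compact_continuous_image continuous_intros) auto
  from compact_sums[OF this Cons.IH]
  have "compact {a + y | a y. a \<in> (\<lambda>s. s *\<^sub>R x) ` {0..1} \<and> y \<in> parallelepiped xs}" .
  also have "{a + y | a y. a \<in> (\<lambda>s. s *\<^sub>R x) ` {0..1} \<and> y \<in> parallelepiped xs} =
      parallelepiped (x # xs)"
    unfolding parallelepiped_Cons by blast
  finally show ?case .
qed (simp add: parallelepiped_Nil)

lemma zero_in_parallelepiped: "0 \<in> parallelepiped xs"
  unfolding parallelepiped_def by (auto intro!: exI[of _ "\<lambda>_. 0"])

lemma set_subset_parallelepiped: "set xs \<subseteq> parallelepiped xs"
proof (induction xs)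
  case (Cons x xs)
  have "x \<in> parallelepiped (x # xs)"
    unfolding parallelepiped_Cons using zero_in_parallelepiped[of xs]
    by (force intro: exI[of _ 1])
  moreover have "parallelepiped xs \<subseteq> parallelepiped (x # xs)"
    unfolding parallelepiped_Cons by (force intro: exI[of _ 0])
  ultimately show ?case
    using Cons.IH by auto
qed simp

lemma parallelepiped_subset_span: "parallelepiped xs \<subseteq> span (set xs)"
proof
  fix z
  assume "z \<in> parallelepiped xs"
  then obtain t where z: "z = (\<Sum>i<length xs. t i *\<^sub>R xs ! i)"
    by (auto simp: parallelepiped_def)
  show "z \<in> span (set xs)"
    unfolding z by (intro span_sum span_scale span_base) simp
qed

text \<open>A point of the unit cube is a family of admissible coefficients, relabelled by
  rank.\<close>

lemma parallelepiped_eq_image: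
  fixes ys :: "(real ^ 'n::{finite,linorder}) list"
  assumes "length ys = CARD('n)"
  shows "parallelepiped ys = (*v) (column_matrix ys) ` cbox 0 1"
proof (intro set_eqI iffI)
  fix z
  assume "z \<in> parallelepiped ys"
  then obtain t where t: "z = (\<Sum>i<CARD('n). t i *\<^sub>R ys ! i)" "\<forall>i<CARD('n). 0 \<le> t i \<and> t i \<le> 1"
    by (auto simp: parallelepiped_def assms)
  then have "z = column_matrix ys *v (\<chi> j. t (col_index j))"
    by (simp only: column_matrix_mult_col_index)
  moreover have "(\<chi> j. t (col_index j)) \<in> (cbox 0 1 :: (real, 'n) vec set)"
    using t(2) by (simp add: mem_box_cart)
  ultimately show "z \<in> (*v) (column_matrix ys) ` cbox 0 1"
    by blast
next
  fix z
  assume "z \<in> (*v) (column_matrix ys) ` cbox 0 1"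
  then obtain x where x: "z = column_matrix ys *v x" "x \<in> cbox 0 1"
    by blast
  \<comment> \<open>Beyond the ranks, \<open>inv col_index\<close> is an unspecified index, so
    \<open>t i\<close> is still a coordinate of \<open>x\<close> and the bounds below hold for every
    \<open>i\<close>.\<close>
  define t where "t i = x $ (inv col_index i)" for i
  have "x = (\<chi> j. t (col_index j))"
    by (simp add: t_def vec_eq_iff inv_f_f inj_col_index)
  with x have "z = (\<Sum>i<CARD('n). t i *\<^sub>R ys ! i)"
    by (metis column_matrix_mult_col_index)
  moreover have "0 \<le> t i \<and> t i \<le> 1" for i
    using x(2) by (simp add: t_def mem_box_cart)
  ultimately show "z \<in> parallelepiped ys"
    unfolding parallelepiped_def assms by blast
qed

section \<open>Lebesgue measure in coordinates numbered by rank\<close>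

lemma measurable_vec_col_index [measurable]:
  "(\<lambda>f. (\<chi> j. f (col_index j)) :: real ^ 'n::{finite,linorder})
    \<in> borel_measurable (Pi\<^sub>M {..<CARD('n)} (\<lambda>_. lborel))"
  unfolding borel_measurable_euclidean_space[where 'c = "(real, 'n) vec"] Basis_vec_def
  by (auto simp: inner_axis)

text \<open>Lebesgue measure is determined by its values on open boxes, and the preimage of a box is
  a product of intervals.\<close>

lemma distr_PiM_lborel_col_index:
  "distr (Pi\<^sub>M {..<CARD('n)} (\<lambda>_. lborel)) borel (\<lambda>f. \<chi> j. f (col_index j)) =
    (lborel :: (real ^ 'n::{finite,linorder}) measure)"
    (is "distr ?M _ ?h = _")
proof (rule lborel_eqI[symmetric])
  interpret product_sigma_finite "\<lambda>_::nat. lborel :: real measure" ..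
  fix l u :: "(real, 'n) vec"
  assume le: "\<And>b. b \<in> Basis \<Longrightarrow> l \<bullet> b \<le> u \<bullet> b"
  have le: "l $ j \<le> u $ j" for j
    using le[of "axis j 1"] by (simp add: inner_axis axis_in_Basis_iff)
  define I where "I i = {l $ inv col_index i <..< u $ inv col_index i}" for i
  have I_index: "I (col_index j) = {l $ j <..< u $ j}" for j
    by (simp add: I_def inv_f_f inj_col_index)
  have "?h -` box l u \<inter> space ?M = Pi\<^sub>E {..<CARD('n)} I"
  proof (intro set_eqI)
    fix f
    have "(\<forall>j::'n. f (col_index j) \<in> I (col_index j)) \<longleftrightarrow> (\<forall>i\<in>{..<CARD('n)}. f i \<in> I i)"
      by (simp add: bij_betw_imp_surj_on[OF bij_betw_col_index, symmetric] del: lessThan_iff)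
    then show "f \<in> ?h -` box l u \<inter> space ?M \<longleftrightarrow> f \<in> Pi\<^sub>E {..<CARD('n)} I"
      by (auto simp: mem_box_cart I_index space_PiM PiE_iff)
  qed
  then have "emeasure (distr ?M borel ?h) (box l u) = emeasure ?M (Pi\<^sub>E {..<CARD('n)} I)"
    by (simp add: emeasure_distr)
  also have "\<dots> = (\<Prod>i<CARD('n). emeasure lborel (I i))"
    by (rule emeasure_PiM) (auto simp: I_def)
  also have "\<dots> = (\<Prod>j\<in>(UNIV :: 'n set). emeasure lborel (I (col_index j)))"
    by (rule prod.reindex_bij_betw[OF bij_betw_col_index, symmetric])
  also have "\<dots> = (\<Prod>j\<in>(UNIV :: 'n set). ennreal (u $ j - l $ j))"
    by (simp add: I_index le)
  also have "\<dots> = ennreal (\<Prod>b\<in>Basis. (u - l) \<bullet> b)"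
    by (simp add: prod_ennreal le Basis_vec_def inner_axis axis_eq_axis prod.UNION_disjoint)
  finally show "emeasure (distr ?M borel ?h) (box l u) = ennreal (\<Prod>b\<in>Basis. (u - l) \<bullet> b)" .
qed simp

section \<open>Volume of a linear image of the cube\<close>

text \<open>The library proves the transformation formula for linear maps only for index types of class
  \<open>wellorder\<close>, which a variable of sort \<open>{finite,linorder}\<close> is not known to inhabit; the
  following copy of such a type does.\<close>

typedef 'n wo_copy = "UNIV :: 'n set" ..

lemma bij_Rep_wo_copy: "bij (Rep_wo_copy :: 'n wo_copy \<Rightarrow> 'n)"
  by (metis Rep_wo_copy_inverse Abs_wo_copy_inverse UNIV_I bij_iff)

instance wo_copy :: (finite) finite
proof
  show "finite (UNIV :: 'a wo_copy set)"
    using bij_betw_finite[OF bij_Rep_wo_copy[where 'n = 'a]] by simp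
qed

instantiation wo_copy :: (linorder) linorder
begin

definition "i \<le> j \<longleftrightarrow> Rep_wo_copy i \<le> Rep_wo_copy j"

definition "i < j \<longleftrightarrow> Rep_wo_copy i < Rep_wo_copy j"

instance
  by standard (auto simp: less_eq_wo_copy_def less_wo_copy_def simp flip: Rep_wo_copy_inject)

end

instance wo_copy :: ("{finite,linorder}") wellorder
proof
  fix P :: "'a wo_copy \<Rightarrow> bool" and a
  assume step: "\<And>i. (\<And>j. j < i \<Longrightarrow> P j) \<Longrightarrow> P i"
  show "P a"
  \<comment> \<open>The rank is strictly increasing, so induction on this natural number is
    well-founded induction along the order.\<close>
  proof (induction a rule: measure_induct_rule[where f = col_index])
    case (less i)
    have "col_index j < col_index i" if "j < i" for j
      unfolding col_index_def using that by (intro psubset_card_mono) auto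
    then show ?case
      using less step by blast
  qed
qed

lemma CARD_wo_copy [simp]: "CARD('n wo_copy) = CARD('n)"
  by (rule bij_betw_same_card[OF bij_Rep_wo_copy])

lemma col_index_Rep_wo_copy:
  "col_index (Rep_wo_copy i) = col_index (i :: 'n::{finite,linorder} wo_copy)"
proof -
  have "bij_betw Rep_wo_copy {l. l < i} {l. l < Rep_wo_copy i}"
    unfolding bij_betw_def
    by (auto simp: less_wo_copy_def inj_on_def Rep_wo_copy_inject image_iff)
      (metis Abs_wo_copy_inverse UNIV_I)
  then show ?thesis
    unfolding col_index_def by (rule bij_betw_same_card[symmetric])
qed

text \<open>Conjugation by \<open>\<pi>\<close>, which is \<open>map_permutation UNIV \<pi>\<close>,
  is a sign-preserving bijection between the permutations in the two Leibniz sums, and it matches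
  the products term by term.\<close>

lemma det_reindex:
  fixes A :: "'a::comm_ring_1 ^ 'n ^ 'n" and \<pi> :: "'m::finite \<Rightarrow> 'n"
  assumes "bij \<pi>"
  shows "det (\<chi> i j. A $ \<pi> i $ \<pi> j) = det A"
proof -
  have inj: "inj \<pi>" and surj: "surj \<pi>"
    using assms by (auto simp: bij_def)
  have \<pi>': "bij (inv \<pi>)"
    using assms by (rule bij_imp_bij_inv)
  have map: "map_permutation UNIV \<pi> p (\<pi> i) = \<pi> (p i)" for p i
    by (simp add: map_permutation_def restrict_id_def surj inj)
  show ?thesis
    unfolding det_def
  proof (rule sum.reindex_bij_witness[where i = "map_permutation UNIV (inv \<pi>)"
        and j = "map_permutation UNIV \<pi>"])
    fix p :: "'m \<Rightarrow> 'm"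
    assume p: "p \<in> {p. p permutes UNIV}"
    then show "map_permutation UNIV (inv \<pi>) (map_permutation UNIV \<pi> p) = p"
      by (intro map_permutation_compose_inv[OF assms]) (auto simp: inj)
    show "map_permutation UNIV \<pi> p \<in> {p. p permutes UNIV}"
      using p map_permutation_permutes[OF assms] by auto
    have "(\<Prod>i\<in>UNIV. A $ i $ map_permutation UNIV \<pi> p i) =
        (\<Prod>i\<in>UNIV. A $ \<pi> i $ map_permutation UNIV \<pi> p (\<pi> i))"
      by (rule prod.reindex_bij_betw[OF assms, symmetric])
    then show "of_int (sign (map_permutation UNIV \<pi> p)) *
          (\<Prod>i\<in>UNIV. A $ i $ map_permutation UNIV \<pi> p i) =
        of_int (sign p) * (\<Prod>i\<in>UNIV. (\<chi> i j. A $ \<pi> i $ \<pi> j) $ i $ p i)"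
      using p by (simp add: sign_map_permutation inj map)
  next
    fix p :: "'n \<Rightarrow> 'n"
    assume p: "p \<in> {p. p permutes UNIV}"
    then show "map_permutation UNIV \<pi> (map_permutation UNIV (inv \<pi>) p) = p"
      by (intro map_permutation_compose_inv[OF \<pi>']) (auto simp: surj_f_inv_f[OF surj])
    show "map_permutation UNIV (inv \<pi>) p \<in> {p. p permutes UNIV}"
      using p map_permutation_permutes[OF \<pi>'] by auto
  qed
qed

text \<open>The transformation formula is applied on \<open>'n wo_copy\<close> and carried back
  along the relabelling \<open>R\<close> of coordinates; \<open>A'\<close> is \<open>A\<close>
  relabelled in the same way.\<close>

lemma emeasure_PiM_linear_image_cube:
  fixes A :: "real ^ 'n::{finite,linorder} ^ 'n::{finite,linorder}"
  defines "N \<equiv> Pi\<^sub>M {..<CARD('n)} (\<lambda>_. lborel)"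
  shows "emeasure N {c \<in> space N. (\<chi> j. c (col_index j)) \<in> (*v) A ` cbox 0 1} = ennreal \<bar>det A\<bar>"
proof -
  define R :: "(real, 'n) vec \<Rightarrow> (real, 'n wo_copy) vec" where "R x = (\<chi> j. x $ Rep_wo_copy j)" for x
  define A' where "A' = (\<chi> i j. A $ Rep_wo_copy i $ Rep_wo_copy j)"
  have Rep_ex: "\<exists>j. i = Rep_wo_copy j" for i :: 'n
    by (metis Abs_wo_copy_inverse UNIV_I)
  have R_eq: "R x = R y \<longleftrightarrow> x = y" for x y
    unfolding R_def vec_eq_iff vec_lambda_beta using Rep_ex by metis
  have R_mult: "R (A *v x) = A' *v R x" for x
  proof -
    have "(\<Sum>j\<in>UNIV. A $ i $ j * x $ j) =
        (\<Sum>j\<in>UNIV. A $ i $ Rep_wo_copy j * x $ Rep_wo_copy j)" for i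
      by (rule sum.reindex_bij_betw[OF bij_Rep_wo_copy, symmetric])
    then show ?thesis
      by (simp add: R_def A'_def matrix_vector_mult_def)
  qed
  have R_cube: "R ` cbox 0 1 = cbox 0 1"
  proof (intro equalityI subsetI)
    fix y :: "(real, 'n wo_copy) vec"
    assume y: "y \<in> cbox 0 1"
    let ?x = "\<chi> i. y $ Abs_wo_copy i"
    have "y = R ?x"
      by (simp add: R_def vec_eq_iff Rep_wo_copy_inverse)
    moreover have "?x \<in> cbox 0 1"
      using y by (simp add: mem_box_cart)
    ultimately show "y \<in> R ` cbox 0 1"
      by blast
  qed (auto simp: R_def mem_box_cart)
  have R_image: "R x \<in> (*v) A' ` cbox 0 1 \<longleftrightarrow> x \<in> (*v) A ` cbox 0 1" for x
  proof -
    have "(*v) A' ` cbox 0 1 = R ` (*v) A ` cbox 0 1"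
      by (simp add: R_cube[symmetric] image_image R_mult)
    then show ?thesis
      using R_eq by auto
  qed
  \<comment> \<open>Corresponding indices have equal ranks, so \<open>?h\<close> is \<open>R\<close>
    after the coordinate map for \<open>'n\<close>. Equal cardinalities make \<open>N\<close> the
    product measure for both index types.\<close>
  let ?h = "\<lambda>c. (\<chi> j. c (col_index j)) :: (real, 'n wo_copy) vec"
  have h: "?h c = R (\<chi> j. c (col_index j))" for c
    by (simp add: R_def vec_eq_iff col_index_Rep_wo_copy)
  have N: "N = Pi\<^sub>M {..<CARD('n wo_copy)} (\<lambda>_. lborel)"
    by (simp add: N_def)
  have comp: "compact ((*v) A' ` cbox 0 1)"
    by (intro compact_continuous_image matrix_vector_mult_linear_continuous_on) auto
  then have [measurable]: "(*v) A' ` cbox 0 1 \<in> sets borel"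
    by (rule borel_compact)
  \<comment> \<open>The unit cube has measure 1, so only the determinant factor remains.\<close>
  have "measure lebesgue ((*v) A' ` cbox 0 1) = \<bar>det A'\<bar>"
    by (subst measure_linear_image[OF matrix_vector_mul_linear])
      (auto simp: content_cbox_if_cart interval_eq_empty_cart)
  also have "measure lebesgue ((*v) A' ` cbox 0 1) = measure lborel ((*v) A' ` cbox 0 1)"
    by (rule measure_completion) simp
  also have "det A' = det A"
    unfolding A'_def by (rule det_reindex[OF bij_Rep_wo_copy])
  finally have "measure lborel ((*v) A' ` cbox 0 1) = \<bar>det A\<bar>" .
  then have "ennreal \<bar>det A\<bar> = emeasure lborel ((*v) A' ` cbox 0 1)"
    using emeasure_compact_finite[OF comp] by (simp add: emeasure_eq_ennreal_measure)
  also have "\<dots> = emeasure N (?h -` ((*v) A' ` cbox 0 1) \<inter> space N)"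
    unfolding N distr_PiM_lborel_col_index[symmetric]
    by (rule emeasure_distr[OF measurable_vec_col_index]) measurable
  also have "?h -` ((*v) A' ` cbox 0 1) \<inter> space N =
      {c \<in> space N. (\<chi> j. c (col_index j)) \<in> (*v) A ` cbox 0 1}"
    unfolding vimage_def h R_image by blast
  finally show ?thesis ..
qed

section \<open>Thickening in the normal direction\<close>

text \<open>The \<open>m\<close>-dimensional volume is compared with Lebesgue measure on \<open>real ^ 'n\<close> by thickening
  the parallelepiped by a unit segment in the normal direction \<open>\<nu>\<close>.\<close>

lemma measure_coordinates_parallelepiped:
  fixes \<nu> :: "real ^ 'n::{finite,linorder}"
  assumes m: "CARD('n) = Suc m" and len: "length xs = m"
    and e: "orthonormal_family m e"
    and sub: "parallelepiped xs \<subseteq> span (e ` {..<m})"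
    and \<nu>: "norm \<nu> = 1" "\<And>i. i < m \<Longrightarrow> \<nu> \<bullet> e i = 0"
  shows "measure (Pi\<^sub>M {..<m} (\<lambda>_. lborel))
      {c \<in> space (Pi\<^sub>M {..<m} (\<lambda>_. lborel)). (\<Sum>i<m. c i *\<^sub>R e i) \<in> parallelepiped xs} =
    \<bar>det_list (\<nu> # xs)\<bar>"
    (is "measure ?M ?S = _")
proof -
  interpret product_sigma_finite "\<lambda>_::nat. lborel :: real measure" ..
  \<comment> \<open>Placing \<open>\<nu>\<close> at the free position \<open>m\<close> completes
    \<open>e\<close> to an orthonormal basis of the whole space. \<open>B\<close> below is the prism
    over the parallelepiped in the coordinates of this basis.\<close>
  define E where "E = e(m := \<nu>)"
  let ?ys = "\<nu> # xs"
  let ?N = "Pi\<^sub>M {..<CARD('n)} (\<lambda>_. lborel :: real measure)"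
  define B where "B = {c \<in> space ?N. (\<Sum>i<CARD('n). c i *\<^sub>R E i) \<in> parallelepiped ?ys}"
  have [measurable]: "parallelepiped zs \<in> sets borel" for zs :: "(real, 'n) vec list"
    by (intro borel_compact compact_parallelepiped)
  have A [measurable]: "?S \<in> sets ?M"
    by measurable
  have B [measurable]: "B \<in> sets ?N"
    unfolding B_def by measurable
  have \<nu>\<nu>: "\<nu> \<bullet> \<nu> = 1"
    using \<nu>(1) by (simp add: norm_eq_1)
  have orth: "\<nu> \<bullet> x = 0" if "x \<in> span (e ` {..<m})" for x
    using that orthogonal_to_span[of x "e ` {..<m}" \<nu>] \<nu>(2) by (auto simp: orthogonal_def)

  \<comment> \<open>The base lies in the span of \<open>e\<close>, orthogonal to
    \<open>\<nu>\<close>. The inner product with \<open>\<nu>\<close> therefore recovers the height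
    \<open>y\<close>, and membership in the prism splits into base and height.\<close>
  have mem: "c(m := y) \<in> B \<longleftrightarrow> c \<in> ?S \<and> y \<in> {0..1}" if c: "c \<in> space ?M" for c y
  proof -
    let ?q = "\<Sum>i<m. c i *\<^sub>R e i"
    have q: "?q \<in> span (e ` {..<m})"
      by (intro span_sum span_scale span_base) simp
    have "(\<Sum>i<CARD('n). (c(m := y)) i *\<^sub>R E i) = y *\<^sub>R \<nu> + ?q"
      by (simp add: m E_def)
    moreover have "y *\<^sub>R \<nu> + ?q \<in> parallelepiped ?ys \<longleftrightarrow> y \<in> {0..1} \<and> ?q \<in> parallelepiped xs"
    proof
      assume "y *\<^sub>R \<nu> + ?q \<in> parallelepiped ?ys"
      then obtain s p where sp: "y *\<^sub>R \<nu> + ?q = s *\<^sub>R \<nu> + p" "s \<in> {0..1}" "p \<in> parallelepiped xs"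
        by (auto simp: parallelepiped_Cons)
      have "\<nu> \<bullet> (y *\<^sub>R \<nu> + ?q) = y" "\<nu> \<bullet> (s *\<^sub>R \<nu> + p) = s"
        using orth[OF q] orth[of p] sp(3) sub by (auto simp: inner_add_right \<nu>\<nu>)
      with sp show "y \<in> {0..1} \<and> ?q \<in> parallelepiped xs"
        by auto
    qed (auto simp: parallelepiped_Cons)
    moreover have "c(m := y) \<in> space ?N"
      using c by (auto simp: space_PiM m PiE_iff extensional_def)
    ultimately show ?thesis
      using c by (auto simp: B_def)
  qed
  have "emeasure ?N B = (\<integral>\<^sup>+ c. indicator B c \<partial>Pi\<^sub>M (insert m {..<m}) (\<lambda>_. lborel))"
    using B by (simp add: m lessThan_Suc)
  \<comment> \<open>Tonelli, with coordinate \<open>m\<close> integrated first; its range has length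
    1, which leaves the measure of the base.\<close>
  also have "\<dots> = (\<integral>\<^sup>+ c. (\<integral>\<^sup>+ y. indicator B (c(m := y)) \<partial>lborel) \<partial>?M)"
    using B by (intro product_nn_integral_insert) (auto simp: m lessThan_Suc)
  also have "\<dots> = (\<integral>\<^sup>+ c. (\<integral>\<^sup>+ y. indicator ?S c * indicator {0..1 :: real} y \<partial>lborel) \<partial>?M)"
    by (intro nn_integral_cong) (simp add: mem indicator_def of_bool_conj)
  also have "\<dots> = (\<integral>\<^sup>+ c. indicator ?S c \<partial>?M)"
    by (intro nn_integral_cong) (simp add: nn_integral_cmult)
  also have "\<dots> = emeasure ?M ?S"
    using A by simp
  finally have 1: "emeasure ?M ?S = emeasure ?N B" ..

  \<comment> \<open>The orthogonal matrix from coordinates with respect to \<open>E\<close> to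
    points. Its transpose is its inverse, so \<open>?A\<close> below maps the cube onto the prism in
    these coordinates, and its determinant agrees with that of \<open>?ys\<close> up to
    sign.\<close>
  define Q where "Q = column_matrix (map E [0..<CARD('n)])"
  have Q_mult: "Q *v (\<chi> j. c (col_index j)) = (\<Sum>i<CARD('n). c i *\<^sub>R E i)" for c
    unfolding Q_def column_matrix_mult_col_index by simp
  have E: "E i \<bullet> E j = (if i = j then 1 else 0)" if "i < Suc m" "j < Suc m" for i j
    using that e \<nu>(2) \<nu>\<nu> by (auto simp: E_def orthonormal_family_def inner_commute less_Suc_eq)
  have Q: "orthogonal_matrix Q"
    unfolding orthogonal_matrix_orthonormal_columns
  proof (intro conjI allI impI)
    fix i j :: 'n
    have "col_index i < Suc m" "col_index j < Suc m"
      by (metis m col_index_less)+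
    note E = E[OF this] E[OF this(1) this(1)]
    show "norm (column i Q) = 1"
      using E by (simp add: Q_def norm_eq_1)
    show "orthogonal (column i Q) (column j Q)" if "i \<noteq> j"
      using E that by (simp add: Q_def orthogonal_def)
  qed
  let ?A = "transpose Q ** column_matrix ?ys"
  have Q': "transpose Q *v (Q *v x) = x" "Q *v (transpose Q *v x) = x" for x
    using Q unfolding matrix_vector_mul_assoc orthogonal_matrix_def by simp_all
  have "Q *v x \<in> parallelepiped ?ys \<longleftrightarrow> x \<in> (*v) ?A ` cbox 0 1" for x
  proof -
    have "(*v) ?A ` cbox 0 1 = (*v) (transpose Q) ` parallelepiped ?ys"
      using len m by (simp only: parallelepiped_eq_image list.size image_image matrix_vector_mul_assoc)
    then show ?thesis
      using Q' by (force intro: rev_image_eqI)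
  qed
  then have "B = {c \<in> space ?N. (\<chi> j. c (col_index j)) \<in> (*v) ?A ` cbox 0 1}"
    by (simp add: B_def Q_mult[symmetric])
  then have "emeasure ?N B = ennreal \<bar>det ?A\<bar>"
    by (simp only: emeasure_PiM_linear_image_cube)
  also have "\<bar>det ?A\<bar> = \<bar>det_list ?ys\<bar>"
    using det_orthogonal_matrix[OF Q] by (auto simp: det_mul det_list_eq)
  finally have "emeasure ?M ?S = ennreal \<bar>det_list ?ys\<bar>"
    using 1 by simp
  then show ?thesis
    by (simp add: measure_def)
qed

section \<open>Evaluating the subspace volume\<close>

lemma ex_orthonormal_family:
  fixes S :: "'a::euclidean_space set"
  shows "\<exists>e. orthonormal_family (dim S) e \<and> S \<subseteq> span (e ` {..<dim S})"
proof -
  obtain B where B: "pairwise orthogonal B" "\<And>x. x \<in> B \<Longrightarrow> norm x = 1"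
      "independent B" "card B = dim (span S)" "span B = span S"
    using orthonormal_basis_subspace[OF subspace_span] by metis
  obtain e where e: "bij_betw e {..<dim S} B"
    using ex_bij_betw_nat_finite[of B] B(3,4) independent_imp_finite
    by (metis atLeast0LessThan dim_span)
  have "orthonormal_family (dim S) e"
    unfolding orthonormal_family_def
  proof (intro allI impI)
    fix i j
    assume ij: "i < dim S" "j < dim S"
    then have "e i \<in> B" "e j \<in> B" "e i = e j \<longleftrightarrow> i = j"
      using e by (auto simp: bij_betw_def inj_on_def)
    then show "e i \<bullet> e j = (if i = j then 1 else 0)"
      using B(1,2) by (auto simp: pairwise_def orthogonal_def norm_eq_1)
  qed
  moreover have "e ` {..<dim S} = B"
    using e by (simp add: bij_betw_def)
  ultimately show ?thesis
    using B(5) span_superset by metis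
qed

text \<open>Whatever orthonormal family the choice operator picks, its span contains the
  \<open>m\<close>-dimensional span of \<open>xs\<close> and has dimension at most \<open>m\<close>.
  The two spans agree, so \<open>\<nu>\<close> is normal to the chosen family too.\<close>

lemma subspace_volume_parallelepiped:
  fixes \<nu> :: "real ^ 'n::{finite,linorder}"
  assumes m: "CARD('n) = Suc m" and len: "length xs = m" and dim: "dim (set xs) = m"
    and \<nu>: "norm \<nu> = 1" "\<And>x. x \<in> set xs \<Longrightarrow> \<nu> \<bullet> x = 0"
  shows "subspace_volume m (parallelepiped xs) = \<bar>det_list (\<nu> # xs)\<bar>"
proof -
  define e where
    "e = (SOME e. orthonormal_family m e \<and> parallelepiped xs \<subseteq> span (e ` {..<m}))"
  obtain e' where e': "orthonormal_family m e'" "set xs \<subseteq> span (e' ` {..<m})"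
    using ex_orthonormal_family[of "set xs"] dim by auto
  have "span (set xs) \<subseteq> span (e' ` {..<m})"
    using e'(2) by (rule span_minimal) simp
  with e'(1) have "\<exists>e. orthonormal_family m e \<and> parallelepiped xs \<subseteq> span (e ` {..<m})"
    using parallelepiped_subset_span[of xs] by blast
  then have e: "orthonormal_family m e" and sub: "parallelepiped xs \<subseteq> span (e ` {..<m})"
    unfolding e_def by (metis (mono_tags, lifting) someI_ex)+
  have "dim (e ` {..<m}) \<le> m"
    by (metis card_image_le card_lessThan dim_le_card' finite_imageI finite_lessThan order_trans)
  moreover have "span (set xs) \<subseteq> span (e ` {..<m})"
    using set_subset_parallelepiped[of xs] sub by (intro span_minimal) auto
  ultimately have "span (e ` {..<m}) = span (set xs)"
    using dim by (intro subspace_dim_equal[symmetric]) auto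
  moreover have "\<nu> \<bullet> x = 0" if "x \<in> span (set xs)" for x
    using that orthogonal_to_span[of x "set xs" \<nu>] \<nu>(2) by (auto simp: orthogonal_def)
  ultimately have "\<nu> \<bullet> e i = 0" if "i < m" for i
    using that by (metis imageI lessThan_iff span_base)
  from measure_coordinates_parallelepiped[OF m len e sub \<nu>(1) this] show ?thesis
    by (simp add: subspace_volume_def e_def[symmetric])
qed

subsection \<open>The altitude\<close>

lemma affine_hull_image_eq:
  fixes v :: "'b \<Rightarrow> 'a::real_vector"
  assumes "a \<in> I"
  shows "affine hull (v ` I) = (+) (v a) ` span ((\<lambda>i. v i - v a) ` (I - {a}))"
proof -
  have "span ((\<lambda>x. - v a + x) ` (v ` I - {v a})) = span ((\<lambda>i. v i - v a) ` (I - {a}))"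
  proof -
    \<comment> \<open>If \<open>v i = v a\<close> for some other index \<open>i\<close>, only the
      right-hand family contributes the difference 0. Inserting 0 on both sides hides this and
      leaves the spans unchanged.\<close>
    have "insert 0 ((\<lambda>x. - v a + x) ` (v ` I - {v a})) = insert 0 ((\<lambda>i. v i - v a) ` (I - {a}))"
      by (auto simp: image_iff)
    then show ?thesis
      by (metis span_insert_0)
  qed
  then show ?thesis
    using affine_hull_span2[of "v a" "v ` I"] assms by simp
qed

text \<open>All differences of points of the two hulls have the same component along
  \<open>\<nu>\<close>, so Cauchy-Schwarz gives the lower bound. It is attained once the part of
  \<open>p - q\<close> orthogonal to \<open>\<nu>\<close> is cancelled.\<close>

lemma alt_eq_normal_component:
  fixes p q \<nu> :: "'a::euclidean_space"
  assumes S: "affine hull S = (+) p ` span X" and T: "affine hull T = (+) q ` span Y"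
    and \<nu>: "norm \<nu> = 1" and hyp: "span (X \<union> Y) = {x. \<nu> \<bullet> x = 0}"
  shows "alt S T = \<bar>\<nu> \<bullet> (p - q)\<bar>"
  unfolding alt_def
proof (rule Least_equality)
  let ?c = "p - q"
  have \<nu>\<nu>: "\<nu> \<bullet> \<nu> = 1"
    using \<nu> by (simp add: norm_eq_1)
  have "?c - (\<nu> \<bullet> ?c) *\<^sub>R \<nu> \<in> span (X \<union> Y)"
    by (simp add: hyp inner_diff_right \<nu>\<nu>)
  \<comment> \<open>The part to be cancelled splits along the two direction spaces; moving
    \<open>p\<close> by \<open>- x\<close> and \<open>q\<close> by \<open>y\<close> removes
    it.\<close>
  then obtain x y where xy: "x \<in> span X" "y \<in> span Y" "?c - (\<nu> \<bullet> ?c) *\<^sub>R \<nu> = x + y"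
    by (auto simp: span_Un)
  have "(p - x) - (q + y) = (\<nu> \<bullet> ?c) *\<^sub>R \<nu>"
    using xy(3) by (simp add: algebra_simps)
  then have "\<bar>\<nu> \<bullet> ?c\<bar> = norm ((p - x) - (q + y))"
    by (simp add: \<nu>)
  moreover have "p - x \<in> affine hull S" "q + y \<in> affine hull T"
    using xy(1,2) span_neg by (force simp: S T)+
  ultimately show "\<exists>u\<in>affine hull S. \<exists>u'\<in>affine hull T. \<bar>\<nu> \<bullet> ?c\<bar> = norm (u - u')"
    by blast
next
  fix d
  assume "\<exists>u\<in>affine hull S. \<exists>u'\<in>affine hull T. d = norm (u - u')"
  then obtain x y where xy: "x \<in> span X" "y \<in> span Y" "d = norm ((p + x) - (q + y))"
    by (auto simp: S T)
  have "x \<in> span (X \<union> Y)" "y \<in> span (X \<union> Y)"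
    using xy(1,2) span_mono[of X "X \<union> Y"] span_mono[of Y "X \<union> Y"] by auto
  then have "\<nu> \<bullet> ((p + x) - (q + y)) = \<nu> \<bullet> (p - q)"
    by (simp add: hyp inner_diff_right inner_add_right)
  then show "\<bar>\<nu> \<bullet> (p - q)\<bar> \<le> d"
    using Cauchy_Schwarz_ineq2[of \<nu> "(p + x) - (q + y)"] \<nu> xy(3) by simp
qed

section \<open>The altitude of two complementary faces\<close>

theorem corollary5:
  fixes v :: "nat \<Rightarrow> real ^ 'n::{finite,linorder}"
    and n k :: nat
    and \<sigma> \<tau> \<tau>' :: "(real ^ 'n::{finite,linorder}) set"
    and xs :: "(real ^ 'n::{finite,linorder}) list"
  assumes "n = CARD('n)" and "n \<ge> 2"
    and "\<sigma> = v ` {0..n}" and "inj_on v {0..n}" and "\<not> affine_dependent \<sigma>"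
    and "k \<le> n - 1"
    and "\<tau> = v ` {0..k}" and "\<tau>' = \<sigma> - \<tau>"
    and "xs = map (\<lambda>i. v i - v 0) [1..<k + 1] @ map (\<lambda>j. v j - v n) [k + 1..<n]"
  shows "alt \<tau> \<tau>' =
    \<bar>(v 0 - v n) \<bullet> cross_product xs\<bar> / subspace_volume (n - 1) (parallelepiped xs)"
proof -
  note n = assms(1,2) and k = assms(6)
  define m where "m = n - 1"
  have m: "CARD('n) = Suc m" "n = Suc m" "k \<le> m"
    using n k by (auto simp: m_def)
  define X where "X = (\<lambda>i. v i - v 0) ` {1..k}"
  define Y where "Y = (\<lambda>j. v j - v n) ` {k + 1..<n}"
  define c where "c = v 0 - v n"
  have xs: "set xs = X \<union> Y" and len: "length xs = m"
    using m by (auto simp: assms(9) X_def Y_def)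

  have "{0..k} - {0} = {1..k}"
    by auto
  then have hull_\<tau>: "affine hull \<tau> = (+) (v 0) ` span X"
    using affine_hull_image_eq[of 0 "{0..k}" v] by (simp add: assms(7) X_def)
  have "\<tau>' = v ` ({0..n} - {0..k})"
    unfolding assms(3,7,8) using m by (intro inj_on_image_set_diff[OF assms(4), symmetric]) auto
  also have "{0..n} - {0..k} = {k + 1..n}"
    by auto
  finally have "\<tau>' = v ` {k + 1..n}" .
  moreover have "{k + 1..n} - {n} = {k + 1..<n}"
    by auto
  ultimately have hull_\<tau>': "affine hull \<tau>' = (+) (v n) ` span Y"
    using affine_hull_image_eq[of n "{k + 1..n}" v] m by (simp add: Y_def)

  \<comment> \<open>The edges at \<open>v 0\<close> form a basis. For \<open>i > k\<close> such an
    edge is \<open>(v i - v n) - c\<close>, where the bracket is in the list or, for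
    \<open>i = n\<close>, is 0.\<close>
  have span_UNIV: "span (insert c (set xs)) = UNIV"
  proof -
    have inj: "inj_on (\<lambda>i. - v 0 + v i) {1..n}"
      using assms(4) by (auto simp: inj_on_def)
    have notin: "v 0 \<notin> v ` {1..n}"
      using assms(4) by (force simp: inj_on_def)
    have "\<sigma> = insert (v 0) (v ` {1..n})"
      unfolding assms(3) by (auto simp: image_iff) (metis atLeastAtMost_iff One_nat_def Suc_leI neq0_conv)
    then have "independent ((\<lambda>x. - v 0 + x) ` v ` {1..n})"
      using assms(5) affine_dependent_iff_dependent[OF notin] by simp
    then have ind: "independent ((\<lambda>i. - v 0 + v i) ` {1..n})"
      by (simp add: image_image)
    have "UNIV \<subseteq> span ((\<lambda>i. - v 0 + v i) ` {1..n})"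
      by (rule card_ge_dim_independent[OF _ ind]) (use card_image[OF inj] n(1) in auto)
    also have "\<dots> \<subseteq> span (insert c (set xs))"
    proof (intro span_minimal subspace_span image_subsetI)
      fix i
      assume i: "i \<in> {1..n}"
      have c: "c \<in> span (insert c (set xs))"
        by (simp add: span_base)
      show "- v 0 + v i \<in> span (insert c (set xs))"
      proof (cases "i \<le> k")
        case True
        with i have "v i - v 0 \<in> set xs"
          by (auto simp: xs X_def)
        then show ?thesis
          by (simp add: span_base)
      next
        case False
        have "v i - v n \<in> span (insert c (set xs))"
        proof (cases "i = n")
          case False
          with \<open>\<not> i \<le> k\<close> i have "v i - v n \<in> set xs"
            by (auto simp: xs Y_def)
          then show ?thesis
            by (simp add: span_base)
        qed (simp add: span_zero)
        from span_diff[OF this c] show ?thesis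
          by (simp add: c_def)
      qed
    qed
    finally show ?thesis
      by blast
  qed
  \<comment> \<open>One extra vector raises the dimension by at most one, so the list has dimension
    at least \<open>m\<close>; its length gives the converse bound.\<close>
  have "Suc m = dim (insert c (set xs))"
    using span_UNIV by (metis DIM_cart DIM_real dim_UNIV dim_span m(1) mult.right_neutral)
  also have "\<dots> \<le> Suc (dim (set xs))"
    by (simp add: dim_insert)
  finally have "m \<le> dim (set xs)"
    by simp
  moreover have "dim (set xs) \<le> m"
    using dim_le_card'[of "set xs"] card_length[of xs] len by simp
  ultimately have dim: "dim (set xs) = m"
    by simp

  obtain a where a: "a \<noteq> 0" "\<And>y. y \<in> span (set xs) \<Longrightarrow> orthogonal a y"
    using orthogonal_to_subspace_exists[of "set xs"] dim m(1) by auto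
  define \<nu> where "\<nu> = a /\<^sub>R norm a"
  have \<nu>: "norm \<nu> = 1"
    using a(1) by (simp add: \<nu>_def)
  have perp: "\<nu> \<bullet> y = 0" if "y \<in> span (set xs)" for y
    using a(2)[OF that] by (simp add: \<nu>_def orthogonal_def)
  have "\<nu> \<noteq> 0"
    using \<nu> by auto
  \<comment> \<open>One inclusion is orthogonality; equality follows because both subspaces have
    dimension \<open>m\<close>.\<close>
  have hyp: "span (set xs) = {x. \<nu> \<bullet> x = 0}"
  proof (rule subspace_dim_equal)
    show "dim {x. \<nu> \<bullet> x = 0} \<le> dim (span (set xs))"
      using \<open>\<nu> \<noteq> 0\<close> m(1) by (simp add: dim_hyperplane dim)
  qed (auto simp: perp subspace_hyperplane)

  have decomp: "b - (\<nu> \<bullet> b) *\<^sub>R \<nu> \<in> span (set xs)" for b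
    using \<nu> by (simp add: hyp inner_diff_right norm_eq_1)
  \<comment> \<open>A list vector in the first column repeats a later column, so the determinant
    vanishes on the list and, by linearity, on its span.\<close>
  have cross_perp: "x \<bullet> cross_product xs = 0" if "x \<in> span (set xs)" for x
  proof -
    have "set xs \<subseteq> {x. x \<bullet> cross_product xs = 0}"
      using len m(1) by (auto simp: inner_cross_product det_list_Cons_member)
    then show ?thesis
      using that span_minimal[OF _ subspace_hyperplane2] by blast
  qed
  have c_cross: "c \<bullet> cross_product xs = (\<nu> \<bullet> c) * det_list (\<nu> # xs)"
    using cross_perp[OF decomp[of c]] by (simp add: inner_diff_left flip: inner_cross_product)
  have "b \<in> span (set (\<nu> # xs))" for b
  proof -
    have "b - (\<nu> \<bullet> b) *\<^sub>R \<nu> \<in> span (insert \<nu> (set xs))"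
      using decomp[of b] span_mono[of "set xs" "insert \<nu> (set xs)"] by auto
    then show ?thesis
      by (metis diff_add_cancel insertI1 list.simps(15) span_add span_base span_scale)
  qed
  \<comment> \<open>This determinant occurs in both numerator and denominator and has to be
    cancelled.\<close>
  then have "det_list (\<nu> # xs) \<noteq> 0"
    using len m(1) by (intro det_list_nonzero) auto
  moreover have "subspace_volume (n - 1) (parallelepiped xs) = \<bar>det_list (\<nu> # xs)\<bar>"
    using subspace_volume_parallelepiped[OF m(1) len dim \<nu>] perp span_base m(2) by auto
  moreover have "alt \<tau> \<tau>' = \<bar>\<nu> \<bullet> c\<bar>"
    unfolding c_def using xs hyp by (intro alt_eq_normal_component[OF hull_\<tau> hull_\<tau>' \<nu>]) simp
  ultimately show ?thesis
    unfolding c_def[symmetric] c_cross by (simp add: abs_mult)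
qed

end
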